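(* Let $p$ be a constant with $\tfrac12(\sqrt5-1) < p < 1$. Inserting a converging sequence, or more generally any finger sequence, of $n$ elements into an initially empty binary search tree, applying \textsc{RebalanceZigZag} after each insertion, results in a binary search tree in which every node has expected depth $O(\lg n)$.
   Context: A finger sequence is a sequence of distinct keys such that each key after the first is, among all keys inserted so far, the immediate predecessor or the immediate successor of the most recently inserted key. The converging sequence (for $n$ even) is $1, n, 2, n-1, 3, n-2, \ldots, n/2, n/2+1$; increasing and decreasing sequences are also finger sequences. Each new element is first placed as a new leaf $v$ at its standard unbalanced BST position, and then \textsc{RebalanceZigZag}$(v)$ is applied: while $v$ has a parent and an independent coin flip shows tail (tail has probability $p$, head probability $1-p$), set $v\gets$ parent of $v$. Afterwards, if $v$ has a parent and a grandparent: if $v$ and its parent are both left children or both right children, rotate the parent of $v$ up once; otherwise rotate $v$ up twice. ("Rotating $x$ up" is the standard single rotation at the parent of $x$ that moves $x$ one level up.) The depth of a node is the number of edges from it to the root. Expectation is over the coin flips. *)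

theory Defs
  imports
    "HOL-Probability.Probability_Mass_Function"
    "HOL-Library.Tree"
    "HOL-Library.Landau_Symbols"
begin

datatype side = Left | Right

fun insert_leaf :: "'a::linorder \<Rightarrow> 'a tree \<Rightarrow> 'a tree" where
  "insert_leaf x \<langle>\<rangle> = \<langle>\<langle>\<rangle>, x, \<langle>\<rangle>\<rangle>"
| "insert_leaf x \<langle>l, a, r\<rangle> =
     (if x < a then \<langle>insert_leaf x l, a, r\<rangle>
      else if a < x then \<langle>l, a, insert_leaf x r\<rangle>
      else \<langle>l, a, r\<rangle>)"

text \<open>The sides taken from the root down to the node with key \<open>x\<close>,
  in a search tree that contains \<open>x\<close>.\<close>

fun search_path :: "'a::linorder \<Rightarrow> 'a tree \<Rightarrow> side list" where
  "search_path x \<langle>\<rangle> = []"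
| "search_path x \<langle>l, a, r\<rangle> =
     (if x < a then Left # search_path x l
      else if a < x then Right # search_path x r
      else [])"

definition depth :: "'a::linorder \<Rightarrow> 'a tree \<Rightarrow> nat" where
  "depth x t = length (search_path x t)"

text \<open>\<open>rotate_child d t\<close> is the single rotation at the root of \<open>t\<close> that moves its \<open>d\<close>-child up.\<close>

fun rotate_child :: "side \<Rightarrow> 'a tree \<Rightarrow> 'a tree" where
  "rotate_child Left \<langle>\<langle>a, x, b\<rangle>, y, c\<rangle> = \<langle>a, x, \<langle>b, y, c\<rangle>\<rangle>"
| "rotate_child Right \<langle>a, x, \<langle>b, y, c\<rangle>\<rangle> = \<langle>\<langle>a, x, b\<rangle>, y, c\<rangle>"
| "rotate_child _ t = t"

fun update_at :: "side list \<Rightarrow> ('a tree \<Rightarrow> 'a tree) \<Rightarrow> 'a tree \<Rightarrow> 'a tree" where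
  "update_at [] f t = f t"
| "update_at (Left # ds) f \<langle>l, a, r\<rangle> = \<langle>update_at ds f l, a, r\<rangle>"
| "update_at (Right # ds) f \<langle>l, a, r\<rangle> = \<langle>l, a, update_at ds f r\<rangle>"
| "update_at (_ # _) f \<langle>\<rangle> = \<langle>\<rangle>"

text \<open>From here on a node is addressed by its \<^emph>\<open>position\<close>, the list of sides read upwards from the
  node to the root: \<open>[]\<close> is the root, and \<open>d # ds\<close> is the \<open>d\<close>-child of its parent \<open>ds\<close>. Rotating the
  node at position \<open>d # ds\<close> up moves it to position \<open>ds\<close>.\<close>

fun rotate_up :: "side list \<Rightarrow> 'a tree \<Rightarrow> 'a tree" where
  "rotate_up [] t = t"
| "rotate_up (d # ds) t = update_at (rev ds) (rotate_child d) t"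

text \<open>The coin shows tail iff the sample of \<open>bernoulli_pmf p\<close> is \<open>True\<close>.\<close>

fun climb :: "real \<Rightarrow> side list \<Rightarrow> side list pmf" where
  "climb p [] = return_pmf []"
| "climb p (d # ds) =
     bernoulli_pmf p \<bind> (\<lambda>tail. if tail then climb p ds else return_pmf (d # ds))"

fun restructure :: "side list \<Rightarrow> 'a tree \<Rightarrow> 'a tree" where
  "restructure (d # e # ds) t =
     (if d = e then rotate_up (e # ds) t
      else rotate_up (e # ds) (rotate_up (d # e # ds) t))"
| "restructure _ t = t"

definition rebalance_zigzag :: "real \<Rightarrow> side list \<Rightarrow> 'a tree \<Rightarrow> 'a tree pmf" where
  "rebalance_zigzag p v t = map_pmf (\<lambda>w. restructure w t) (climb p v)"

definition insert_zigzag :: "real \<Rightarrow> 'a::linorder \<Rightarrow> 'a tree \<Rightarrow> 'a tree pmf" where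
  "insert_zigzag p x t =
     (let t' = insert_leaf x t in rebalance_zigzag p (rev (search_path x t')) t')"

definition zigzag_tree :: "real \<Rightarrow> 'a::linorder list \<Rightarrow> 'a tree pmf" where
  "zigzag_tree p xs = foldl (\<lambda>T x. T \<bind> insert_zigzag p x) (return_pmf \<langle>\<rangle>) xs"

definition imm_pred :: "'a::linorder set \<Rightarrow> 'a \<Rightarrow> 'a \<Rightarrow> bool" where
  "imm_pred S x y \<longleftrightarrow> x \<in> S \<and> y \<in> S \<and> x < y \<and> \<not> (\<exists>z\<in>S. x < z \<and> z < y)"

definition finger_seq :: "'a::linorder list \<Rightarrow> bool" where
  "finger_seq xs \<longleftrightarrow> distinct xs \<and>
     (\<forall>i. Suc i < length xs \<longrightarrow>
        (let S = set (take (Suc (Suc i)) xs) in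
           imm_pred S (xs ! Suc i) (xs ! i) \<or> imm_pred S (xs ! i) (xs ! Suc i)))"

text \<open>Meaningful only for even \<open>n\<close>.\<close>

definition converging :: "nat \<Rightarrow> nat list" where
  "converging n = concat (map (\<lambda>i. [i, n + 1 - i]) [1..<Suc (n div 2)])"

end

theory Submission
  imports Defs "HOL-Library.Sublist"
begin

text \<open>Let \<open>D\<close> be the depth at which a new key becomes a leaf. Leaf insertion commutes with rotations,
  and both gaps next to the new key move up by one whenever the rebalancing rotates anything. Hence
  the next key of a finger sequence becomes a leaf at depth \<open>D\<close> if there was a rotation and at depth
  \<open>D + 1\<close> otherwise, the latter with probability \<open>p ^ (D - 1)\<close>. Consequently the expectation of
  \<open>(1 / p) ^ D\<close> grows at most linearly, and \<open>D\<close> is logarithmic in expectation. For \<open>1 - p \<le> p\<^sup>2\<close> the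
  expected growth of the depth of any old key in one insertion is at most \<open>p ^ (D - 1)\<close>, the expected
  growth of \<open>D\<close>; so the expected depth of a key never overtakes the expected insertion depth.\<close>

section \<open>Search trees under leaf insertion and rotation\<close>

lemma set_tree_insert_leaf [simp]: "set_tree (insert_leaf x t) = insert x (set_tree t)"
  by (induction t) auto

lemma bst_insert_leaf: "bst t \<Longrightarrow> bst (insert_leaf x t)"
  by (induction t) auto

lemma inorder_rotate_child [simp]: "inorder (rotate_child d t) = inorder t"
  by (induction d t rule: rotate_child.induct) auto

lemma inorder_update_at:
  "(\<And>s. inorder (f s) = inorder s) \<Longrightarrow> inorder (update_at ds f t) = inorder t"
  by (induction ds f t rule: update_at.induct) auto

lemma inorder_restructure [simp]: "inorder (restructure ds t) = inorder t"
  by (induction ds t rule: restructure.induct) (auto simp: inorder_update_at)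

lemma set_tree_restructure [simp]: "set_tree (restructure ds t) = set_tree t"
  by (metis inorder_restructure set_inorder)

lemma bst_restructure [simp]: "bst (restructure ds t) \<longleftrightarrow> bst t"
  by (simp add: bst_iff_sorted_wrt_less)

lemma search_path_insert_leaf_mem:
  "x \<in> set_tree t \<Longrightarrow> bst t \<Longrightarrow> search_path x (insert_leaf y t) = search_path x t"
  by (induction t) (auto dest: order.strict_trans)

text \<open>The keys \<open>x\<close> and \<open>y\<close> lie in the same gap between the keys of
  \<open>t\<close>, so both searches run to the same empty subtree. There \<open>x\<close> becomes a
  leaf, and \<open>y\<close> can only become its child.\<close>

lemma search_path_insert_neighbour:
  assumes "bst t" "x \<notin> set_tree t" "y \<notin> set_tree t" "x \<noteq> y"
    and "\<And>a. a \<in> set_tree t \<Longrightarrow> a < x \<longleftrightarrow> a < y"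
  shows "\<exists>d. search_path y (insert_leaf y (insert_leaf x t)) =
           search_path x (insert_leaf x t) @ [d]"
  using assms
proof (induction t)
  case Leaf
  then show ?case by auto
next
  case (Node l a r)
  have "a < x \<longleftrightarrow> a < y" "x \<noteq> a" "y \<noteq> a" using Node.prems by auto
  then consider "x < a" "y < a" | "a < x" "a < y" by (metis linorder_neqE)
  then show ?case
  proof cases
    case 1
    then show ?thesis using Node.IH(1) Node.prems by auto
  next
    case 2
    then have "\<not> x < a" "\<not> y < a" by auto
    then show ?thesis using 2 Node.IH(2) Node.prems by auto
  qed
qed

text \<open>The climb stops at depth \<open>k\<close>; the key \<open>x\<close> only serves to point at that node.\<close>

definition zigzag_at :: "nat \<Rightarrow> 'a::linorder \<Rightarrow> 'a tree \<Rightarrow> 'a tree" where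
  "zigzag_at k x t = restructure (rev (take k (search_path x t))) t"

section \<open>Locality of the rotations and their effect on depths\<close>

text \<open>Positions are read upwards, so a side appended at the end puts a new root on top. Only
  the first two sides decide which rotations happen, and with both present the new root takes no
  part in them.\<close>

lemma restructure_snoc:
  assumes "2 \<le> length ds"
  shows "restructure (ds @ [Left]) \<langle>l, a, r\<rangle> = \<langle>restructure ds l, a, r\<rangle>"
    and "restructure (ds @ [Right]) \<langle>l, a, r\<rangle> = \<langle>l, a, restructure ds r\<rangle>"
proof -
  obtain d e es where "ds = d # e # es"
    using assms by (cases ds; cases "tl ds") auto
  then show "restructure (ds @ [Left]) \<langle>l, a, r\<rangle> = \<langle>restructure ds l, a, r\<rangle>"
    and "restructure (ds @ [Right]) \<langle>l, a, r\<rangle> = \<langle>l, a, restructure ds r\<rangle>" by auto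
qed

lemma zigzag_at_Suc:
  assumes "2 \<le> k"
  shows "x < a \<Longrightarrow> k \<le> depth x l \<Longrightarrow> zigzag_at (Suc k) x \<langle>l, a, r\<rangle> = \<langle>zigzag_at k x l, a, r\<rangle>"
    and "a < x \<Longrightarrow> k \<le> depth x r \<Longrightarrow> zigzag_at (Suc k) x \<langle>l, a, r\<rangle> = \<langle>l, a, zigzag_at k x r\<rangle>"
  using assms by (auto simp: zigzag_at_def depth_def restructure_snoc)

lemma zigzag_at_2:
  "\<lbrakk>x < b; x < a\<rbrakk> \<Longrightarrow> zigzag_at 2 x \<langle>\<langle>l, b, m\<rangle>, a, r\<rangle> = \<langle>l, b, \<langle>m, a, r\<rangle>\<rangle>"
  "\<lbrakk>b < x; a < x\<rbrakk> \<Longrightarrow> zigzag_at 2 x \<langle>l, a, \<langle>m, b, r\<rangle>\<rangle> = \<langle>\<langle>l, a, m\<rangle>, b, r\<rangle>"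
  "\<lbrakk>b < x; x < a\<rbrakk> \<Longrightarrow> zigzag_at 2 x \<langle>\<langle>l, b, \<langle>m1, c, m2\<rangle>\<rangle>, a, r\<rangle> = \<langle>\<langle>l, b, m1\<rangle>, c, \<langle>m2, a, r\<rangle>\<rangle>"
  "\<lbrakk>x < b; a < x\<rbrakk> \<Longrightarrow> zigzag_at 2 x \<langle>l, a, \<langle>\<langle>m1, c, m2\<rangle>, b, r\<rangle>\<rangle> = \<langle>\<langle>l, a, m1\<rangle>, c, \<langle>m2, b, r\<rangle>\<rangle>"
  by (auto simp: zigzag_at_def numeral_2_eq_2)

text \<open>Peeling off the root reduces every stop at depth \<open>k \<ge> 2\<close> to one whose
  grandparent is the root. Four shapes remain: two zig-zig and two zig-zag. Only the zig-zag shapes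
  expose the stopped node as \<open>c\<close>, because only there is it rotated itself.\<close>

lemma zigzag_induct [consumes 4, case_names left right left_left right_right left_right right_left]:
  assumes "bst t" "x \<in> set_tree t" "2 \<le> k" "k \<le> depth x t"
    and "\<And>l a r k. \<lbrakk>bst \<langle>l, a, r\<rangle>; x \<in> set_tree l; x < a; 2 \<le> k; k \<le> depth x l; P k l\<rbrakk>
      \<Longrightarrow> P (Suc k) \<langle>l, a, r\<rangle>"
    and "\<And>l a r k. \<lbrakk>bst \<langle>l, a, r\<rangle>; x \<in> set_tree r; a < x; 2 \<le> k; k \<le> depth x r; P k r\<rbrakk>
      \<Longrightarrow> P (Suc k) \<langle>l, a, r\<rangle>"
    and "\<And>l b m a r. \<lbrakk>bst \<langle>\<langle>l, b, m\<rangle>, a, r\<rangle>; x \<in> set_tree l; x < a; x < b\<rbrakk>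
      \<Longrightarrow> P 2 \<langle>\<langle>l, b, m\<rangle>, a, r\<rangle>"
    and "\<And>l b m a r. \<lbrakk>bst \<langle>l, a, \<langle>m, b, r\<rangle>\<rangle>; x \<in> set_tree r; a < x; b < x\<rbrakk>
      \<Longrightarrow> P 2 \<langle>l, a, \<langle>m, b, r\<rangle>\<rangle>"
    and "\<And>l b m1 c m2 a r. \<lbrakk>bst \<langle>\<langle>l, b, \<langle>m1, c, m2\<rangle>\<rangle>, a, r\<rangle>; x \<in> set_tree \<langle>m1, c, m2\<rangle>; x < a; b < x\<rbrakk>
      \<Longrightarrow> P 2 \<langle>\<langle>l, b, \<langle>m1, c, m2\<rangle>\<rangle>, a, r\<rangle>"
    and "\<And>l b m1 c m2 a r. \<lbrakk>bst \<langle>l, a, \<langle>\<langle>m1, c, m2\<rangle>, b, r\<rangle>\<rangle>; x \<in> set_tree \<langle>m1, c, m2\<rangle>; a < x; x < b\<rbrakk>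
      \<Longrightarrow> P 2 \<langle>l, a, \<langle>\<langle>m1, c, m2\<rangle>, b, r\<rangle>\<rangle>"
  shows "P k t"
  using assms(1-4)
proof (induction t arbitrary: k)
  case Leaf
  then show ?case by simp
next
  case (Node l a r)
  have "x \<noteq> a" using Node.prems by (auto simp: depth_def)
  show ?case
  proof (cases "k = 2")
    case False
    then obtain k' where k: "k = Suc k'" "2 \<le> k'" using Node.prems by (cases k) auto
    show ?thesis
    proof (cases "x < a")
      case True
      then have "x \<in> set_tree l" "k' \<le> depth x l"
        using Node.prems k by (auto simp: depth_def)
      then show ?thesis using assms(5) Node True k by auto
    next
      case False
      then have "a < x" "x \<in> set_tree r" "k' \<le> depth x r"
        using Node.prems k \<open>x \<noteq> a\<close> by (auto simp: depth_def)
      then show ?thesis using assms(6) Node k by auto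
    qed
  next
    case True
    show ?thesis
    proof (cases "x < a")
      case lt: True
      then have "x \<in> set_tree l" "1 \<le> depth x l" using Node.prems True by (auto simp: depth_def)
      then obtain l1 b m where l: "l = \<langle>l1, b, m\<rangle>" by (cases l) auto
      have "x \<noteq> b" using \<open>1 \<le> depth x l\<close> l by (auto simp: depth_def)
      then consider "x < b" "x \<in> set_tree l1" | "b < x" "x \<in> set_tree m"
        using \<open>x \<in> set_tree l\<close> Node.prems(1) l by (auto)
      then show ?thesis
      proof cases
        case 1
        then show ?thesis using assms(7) Node.prems(1) lt l True by simp
      next
        case 2
        then obtain m1 c m2 where "m = \<langle>m1, c, m2\<rangle>" by (cases m) auto
        then show ?thesis using assms(9)[of l1 b m1 c m2 a r] 2 Node.prems(1) lt l True by simp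
      qed
    next
      case False
      then have gt: "a < x" using \<open>x \<noteq> a\<close> by simp
      then have "x \<in> set_tree r" "1 \<le> depth x r"
        using Node.prems True by (auto simp: depth_def split: if_splits)
      then obtain m b r1 where r: "r = \<langle>m, b, r1\<rangle>" by (cases r) auto
      have "x \<noteq> b" using \<open>1 \<le> depth x r\<close> r by (auto simp: depth_def)
      then consider "b < x" "x \<in> set_tree r1" | "x < b" "x \<in> set_tree m"
        using \<open>x \<in> set_tree r\<close> Node.prems(1) r by (auto)
      then show ?thesis
      proof cases
        case 1
        then show ?thesis using assms(8) Node.prems(1) gt r True by simp
      next
        case 2
        then obtain m1 c m2 where "m = \<langle>m1, c, m2\<rangle>" by (cases m) auto
        then show ?thesis using assms(10)[of l a m1 c m2 b r1] 2 Node.prems(1) gt r True by simp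
      qed
    qed
  qed
qed

text \<open>Rotations preserve the order of keys and of gaps, so \<open>y\<close> ends in the same
  gap before and after them. Since \<open>x\<close> is already in the tree, inserting
  \<open>y\<close> leaves its search path alone, and the same nodes are rotated.\<close>

lemma insert_leaf_zigzag_at:
  assumes "bst t" "x \<in> set_tree t" "2 \<le> k" "k \<le> depth x t"
  shows "insert_leaf y (zigzag_at k x t) = zigzag_at k x (insert_leaf y t)"
  using assms
proof (induction rule: zigzag_induct)
  case (left l a r k)
  then have "depth x (insert_leaf y l) = depth x l"
    by (simp add: depth_def search_path_insert_leaf_mem)
  with left show ?case by (auto simp: zigzag_at_Suc)
next
  case (right l a r k)
  then have "depth x (insert_leaf y r) = depth x r"
    by (simp add: depth_def search_path_insert_leaf_mem)
  with right show ?case by (auto simp: zigzag_at_Suc)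
qed (auto simp: zigzag_at_2)

text \<open>Both subtrees of the stopped node rise by exactly one level in every shape. The stopped
  node itself rises by one in a zig-zig and by two in a zig-zag, so equality is claimed only
  strictly below it.\<close>

lemma depth_zigzag_at_self:
  assumes "bst t" "x \<in> set_tree t" "2 \<le> k" "k \<le> depth x t"
  shows "k < depth x t \<Longrightarrow> Suc (depth x (zigzag_at k x t)) = depth x t"
    and "depth x (zigzag_at k x t) \<le> depth x t"
  using assms
proof (induction rule: zigzag_induct)
  case (left_right l b m1 c m2 a r)
  then have "\<not> x < b" by auto
  { case 1
    then show ?case
      using left_right \<open>\<not> x < b\<close>
      by (cases x c rule: linorder_cases) (auto simp: zigzag_at_2 depth_def) }
  { case 2
    then show ?case
      using left_right \<open>\<not> x < b\<close>
      by (cases x c rule: linorder_cases) (auto simp: zigzag_at_2 depth_def) }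
next
  case (right_left l b m1 c m2 a r)
  then have "\<not> x < a" by auto
  { case 1
    then show ?case
      using right_left \<open>\<not> x < a\<close>
      by (cases x c rule: linorder_cases) (auto simp: zigzag_at_2 depth_def) }
  { case 2
    then show ?case
      using right_left \<open>\<not> x < a\<close>
      by (cases x c rule: linorder_cases) (auto simp: zigzag_at_2 depth_def) }
qed (auto simp: zigzag_at_2 zigzag_at_Suc depth_def)

text \<open>The value of \<open>lca\<close> is the depth at which the search for \<open>z\<close>
  leaves the path to \<open>x\<close>. For \<open>k \<le> lca t\<close> the key \<open>z\<close> is
  sought at or below the stopped node and rises. Leaving at the parent costs nothing, leaving at the
  grandparent costs one level, and leaving higher up changes nothing.\<close>

lemma depth_zigzag_at:
  fixes t :: "'a::linorder tree" and z :: 'a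
  assumes "bst t" "x \<in> set_tree t" "2 \<le> k" "k \<le> depth x t"
  defines "lca \<equiv> \<lambda>t. length (longest_common_prefix (search_path z t) (search_path x t))"
  shows "real (depth z (zigzag_at k x t)) \<le>
    real (depth z t) + (if k = lca t + 2 then 1 else 0) - (if k \<le> lca t then 1 else 0)"
  using assms(1-4) unfolding lca_def
proof (induction rule: zigzag_induct)
  case (left l a r k)
  then show ?case by (cases z a rule: linorder_cases) (auto simp: zigzag_at_Suc depth_def)
next
  case (right l a r k)
  then show ?case by (cases z a rule: linorder_cases) (auto simp: zigzag_at_Suc depth_def)
qed (auto simp: zigzag_at_2 depth_def)


section \<open>Expectations over the coin flips\<close>

lemma finite_set_pmf_climb: "finite (set_pmf (climb p ds))"
  by (induction ds) (auto split: if_splits)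

lemma finite_set_pmf_insert_zigzag: "finite (set_pmf (insert_zigzag p x t))"
  by (simp add: insert_zigzag_def rebalance_zigzag_def Let_def finite_set_pmf_climb)

lemma expectation_bind_finite:
  fixes h :: "'b \<Rightarrow> real"
  assumes "finite (set_pmf M)" "\<And>x. finite (set_pmf (f x))"
  shows "measure_pmf.expectation (M \<bind> f) h =
    measure_pmf.expectation M (\<lambda>x. measure_pmf.expectation (f x) h)"
  using assms
  by (subst pmf_expectation_bind[where A = "set_pmf M"])
    (auto simp: integral_measure_pmf[where A = "set_pmf M"] intro: integral_measure_pmf)

text \<open>The climb ends after \<open>j\<close> tails and one head, or at the root after
  \<open>length ds\<close> tails, where no further head is required.\<close>

lemma expectation_climb:
  fixes f :: "side list \<Rightarrow> real"
  assumes "0 \<le> p" "p \<le> 1"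
  shows "measure_pmf.expectation (climb p ds) f =
    (\<Sum>j<length ds. (1 - p) * p ^ j * f (drop j ds)) + p ^ length ds * f []"
proof (induction ds)
  case (Cons d ds)
  have "measure_pmf.expectation (climb p (d # ds)) f =
      p * measure_pmf.expectation (climb p ds) f + (1 - p) * f (d # ds)"
    using assms
    by (simp add: expectation_bind_finite finite_set_pmf_climb del: integral_bernoulli_pmf)
      simp
  also have "\<dots> = (\<Sum>j<length (d # ds). (1 - p) * p ^ j * f (drop j (d # ds)))
      + p ^ length (d # ds) * f []"
    unfolding Cons.IH
    by (simp only: length_Cons sum.lessThan_Suc_shift)
      (simp add: algebra_simps sum_distrib_left sum_subtractf sum.distrib)
  finally show ?case .
qed simp

text \<open>After \<open>j\<close> tails the climb stands at depth \<open>D - j\<close>. Stops at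
  depth 1 and 0 rotate nothing, and their weights add up to
  \<open>(1 - p) * p ^ (D - 1) + p ^ D = p ^ (D - 1)\<close>. For \<open>D = 0\<close>, truncated
  subtraction gives the correct weight 1.\<close>

lemma expectation_insert_zigzag:
  fixes f :: "'a::linorder tree \<Rightarrow> real" and x :: 'a and t :: "'a tree"
  assumes "0 \<le> p" "p \<le> 1"
  defines "s \<equiv> insert_leaf x t"
  defines "D \<equiv> depth x s"
  shows "measure_pmf.expectation (insert_zigzag p x t) f =
    (\<Sum>j<D - 1. (1 - p) * p ^ j * f (zigzag_at (D - j) x s)) + p ^ (D - 1) * f s"
proof -
  have *: "restructure (drop j (rev (search_path x s))) s = zigzag_at (D - j) x s" for j
    by (simp add: zigzag_at_def D_def depth_def drop_rev)
  have "measure_pmf.expectation (insert_zigzag p x t) f =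
      (\<Sum>j<D. (1 - p) * p ^ j * f (zigzag_at (D - j) x s)) + p ^ D * f s"
    using assms
    by (simp add: insert_zigzag_def rebalance_zigzag_def expectation_climb * flip: s_def)
      (simp add: D_def depth_def)
  also have "\<dots> = (\<Sum>j<D - 1. (1 - p) * p ^ j * f (zigzag_at (D - j) x s)) + p ^ (D - 1) * f s"
  proof (cases D)
    case (Suc m)
    have "zigzag_at 1 x s = s"
      by (cases "search_path x s") (auto simp: zigzag_at_def)
    then show ?thesis using Suc by (simp add: algebra_simps)
  qed simp
  finally show ?thesis .
qed

lemma sum_geometric_less:
  fixes p :: real
  shows "(\<Sum>j<n. (1 - p) * p ^ j) = 1 - p ^ n"
  by (induction n) (auto simp: algebra_simps)

section \<open>Expected effect of a single insertion\<close>

text \<open>By commutation \<open>y\<close> may be inserted before the rotations, as a child of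
  \<open>x\<close> at depth \<open>D + 1\<close>. It is then strictly below every stopped node, so
  any rotation lifts it by exactly one.\<close>

lemma expectation_next_insertion_depth:
  fixes f :: "nat \<Rightarrow> real" and x y :: "'a::linorder"
  assumes p: "0 \<le> p" "p \<le> 1"
    and t: "bst t" "x \<notin> set_tree t" "y \<notin> set_tree t" "x \<noteq> y"
    and adj: "\<And>a. a \<in> set_tree t \<Longrightarrow> a < x \<longleftrightarrow> a < y"
  defines "D \<equiv> depth x (insert_leaf x t)"
  shows "measure_pmf.expectation (insert_zigzag p x t) (\<lambda>s. f (depth y (insert_leaf y s))) =
    f D + p ^ (D - 1) * (f (Suc D) - f D)"
proof -
  define s where "s = insert_leaf x t"
  have s: "bst s" "x \<in> set_tree s" using t by (auto simp: s_def bst_insert_leaf)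
  obtain d where d: "search_path y (insert_leaf y s) = search_path x s @ [d]"
    using search_path_insert_neighbour[OF t adj] unfolding s_def by blast
  have D: "D = depth x s" by (simp add: D_def s_def)
  then have Dy: "depth y (insert_leaf y s) = Suc D"
    using d by (simp add: depth_def)
  have "depth y (insert_leaf y (zigzag_at (D - j) x s)) = D" if "j < D - 1" for j
  proof -
    let ?k = "D - j"
    have k: "2 \<le> ?k" "?k \<le> depth x s" using that D by auto
    \<comment> \<open>The paths to \<open>x\<close> and \<open>y\<close> share their first
      \<open>D\<close> sides and \<open>?k \<le> D\<close>, so both keys point at the same stopped
      node.\<close>
    have "zigzag_at ?k x (insert_leaf y s) = zigzag_at ?k y (insert_leaf y s)"
      using d k s by (simp add: zigzag_at_def search_path_insert_leaf_mem depth_def)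
    then have "insert_leaf y (zigzag_at ?k x s) = zigzag_at ?k y (insert_leaf y s)"
      using insert_leaf_zigzag_at[OF s k] by simp
    moreover have "Suc (depth y (zigzag_at ?k y (insert_leaf y s))) = Suc D"
      using depth_zigzag_at_self(1)[of "insert_leaf y s" y ?k] s k Dy D
      by (simp add: bst_insert_leaf)
    ultimately show ?thesis by simp
  qed
  then have "measure_pmf.expectation (insert_zigzag p x t) (\<lambda>s. f (depth y (insert_leaf y s))) =
      (\<Sum>j<D - 1. (1 - p) * p ^ j * f D) + p ^ (D - 1) * f (Suc D)"
    using p Dy by (simp add: expectation_insert_zigzag D_def s_def)
  also have "\<dots> = (1 - p ^ (D - 1)) * f D + p ^ (D - 1) * f (Suc D)"
    by (simp only: sum_geometric_less flip: sum_distrib_right)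
  finally show ?thesis by (simp add: algebra_simps)
qed

lemma expectation_depth_new:
  assumes p: "0 \<le> p" "p \<le> 1" and "bst t"
  shows "measure_pmf.expectation (insert_zigzag p x t) (\<lambda>s. real (depth x s)) \<le>
    real (depth x (insert_leaf x t))"
proof -
  define s where "s = insert_leaf x t"
  define D where "D = depth x s"
  have "depth x (zigzag_at (D - j) x s) \<le> D" if "j < D - 1" for j
    using that depth_zigzag_at_self(2)[of s x "D - j"] \<open>bst t\<close>
    by (auto simp: D_def s_def bst_insert_leaf)
  then have "(\<Sum>j<D - 1. (1 - p) * p ^ j * depth x (zigzag_at (D - j) x s)) \<le>
      (\<Sum>j<D - 1. (1 - p) * p ^ j * D)"
    using p by (intro sum_mono mult_left_mono) auto
  also have "\<dots> = (1 - p ^ (D - 1)) * D"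
    by (simp only: sum_geometric_less flip: sum_distrib_right)
  finally show ?thesis
    using p by (simp add: expectation_insert_zigzag algebra_simps flip: s_def D_def)
qed

text \<open>If the search paths of \<open>z\<close> and of the new leaf separate at height \<open>h\<close> above the leaf, then the
  depth of \<open>z\<close> grows by one if the climb stops at height \<open>h - 2\<close> and shrinks by one if it stops at
  height at least \<open>h\<close>. The golden ratio condition, \<open>1 - p \<le> p\<^sup>2\<close>, makes the second effect dominate, up to
  the probability \<open>p ^ (D - 1)\<close> that the climb comes too close to the root for any rotation.\<close>

lemma expectation_depth_old:
  fixes x z :: "'a::linorder"
  assumes p: "0 \<le> p" "p \<le> 1" "1 - p \<le> p\<^sup>2"
    and t: "bst t" "z \<in> set_tree t"
  defines "D \<equiv> depth x (insert_leaf x t)"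
  shows "measure_pmf.expectation (insert_zigzag p x t) (\<lambda>s. real (depth z s)) \<le>
    real (depth z t) + p ^ (D - 1)"
proof -
  define s where "s = insert_leaf x t"
  have s: "bst s" "x \<in> set_tree s" using t by (auto simp: s_def bst_insert_leaf)
  have D: "D = depth x s" by (simp add: D_def s_def)
  have z: "depth z s = depth z t"
    using t by (simp add: s_def depth_def search_path_insert_leaf_mem)
  define a where "a = length (longest_common_prefix (search_path z s) (search_path x s))"
  have "a \<le> D"
    unfolding a_def D depth_def by (intro prefix_length_le longest_common_prefix_prefix2)
  \<comment> \<open>A stop at depth \<open>D - j\<close> has height \<open>j\<close> above the leaf,
    so comparing the stop with \<open>a\<close> becomes comparing \<open>j\<close> with
    \<open>h\<close>.\<close>
  define h where "h = D - a"
  have step: "real (depth z (zigzag_at (D - j) x s)) \<le>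
      real (depth z t) + (if j + 2 = h then 1 else 0) - (if h \<le> j then 1 else 0)"
    if "j < D - 1" for j
  proof -
    have "D - j = a + 2 \<longleftrightarrow> j + 2 = h" "D - j \<le> a \<longleftrightarrow> h \<le> j"
      using that \<open>a \<le> D\<close> by (auto simp: h_def)
    then show ?thesis
      using depth_zigzag_at[OF s, of "D - j" z] that unfolding a_def[symmetric] z D by auto
  qed
  let ?c = "\<lambda>j. (1 - p) * p ^ j"
  have up: "(\<Sum>j<D - 1. ?c j * (if j + 2 = h then 1 else 0)) \<le> p ^ h"
  proof (cases "h < 2")
    case True
    then show ?thesis using p by (simp add: sum.neutral)
  next
    case False
    then obtain i where h: "h = i + 2" by (metis add.commute le_Suc_ex not_less)
    have "(\<Sum>j<D - 1. ?c j * (if j + 2 = h then 1 else 0)) \<le> ?c i"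
      using p by (simp add: h if_distrib[of "\<lambda>x. _ * x"] cong: if_cong)
    \<comment> \<open>The golden ratio condition enters here: the only harmful stop, at height
      \<open>h - 2\<close>, has weight at most \<open>p ^ h\<close>.\<close>
    also have "\<dots> \<le> p\<^sup>2 * p ^ i" using p by (intro mult_right_mono) auto
    finally show ?thesis by (simp only: h power_add mult.commute)
  qed
  \<comment> \<open>For \<open>h \<le> D - 1\<close> the weights of the helpful stops telescope to
    the left-hand side; otherwise the left-hand side is at most 0.\<close>
  have down: "p ^ h - p ^ (D - 1) \<le> (\<Sum>j<D - 1. ?c j * (if h \<le> j then 1 else 0))"
  proof (cases "h \<le> D - 1")
    case True
    have "(\<Sum>j<D - 1. ?c j * (if h \<le> j then 1 else 0)) =
        (\<Sum>j<D - 1. ?c j) - (\<Sum>j<D - 1. if j < h then ?c j else 0)"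
      by (simp only: flip: sum_subtractf) (intro sum.cong, auto)
    also have "(\<Sum>j<D - 1. if j < h then ?c j else 0) = (\<Sum>j<h. ?c j)"
      using True by (intro sum.mono_neutral_cong_right) auto
    finally show ?thesis by (simp only: sum_geometric_less)
  next
    case False
    then have "p ^ h \<le> p ^ (D - 1)" using p by (intro power_decreasing) auto
    then show ?thesis using p
      by (smt (verit) sum_nonneg mult_nonneg_nonneg zero_le_power)
  qed
  have "(\<Sum>j<D - 1. ?c j * depth z (zigzag_at (D - j) x s)) \<le>
      (\<Sum>j<D - 1. ?c j * (real (depth z t) + (if j + 2 = h then 1 else 0) - (if h \<le> j then 1 else 0)))"
    using p by (intro sum_mono mult_left_mono step) auto
  also have "\<dots> = (\<Sum>j<D - 1. ?c j) * depth z t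
      + (\<Sum>j<D - 1. ?c j * (if j + 2 = h then 1 else 0))
      - (\<Sum>j<D - 1. ?c j * (if h \<le> j then 1 else 0))"
    unfolding sum_distrib_right sum.distrib[symmetric] sum_subtractf[symmetric]
    by (intro sum.cong) (auto simp: algebra_simps)
  \<comment> \<open>The two terms \<open>p ^ h\<close> cancel, and only \<open>p ^ (D - 1)\<close>
    survives.\<close>
  also have "\<dots> \<le> (1 - p ^ (D - 1)) * depth z t + p ^ (D - 1)"
    using up down by (simp only: sum_geometric_less)
  finally show ?thesis
    using p z by (simp add: expectation_insert_zigzag algebra_simps flip: s_def D)
qed

section \<open>Trees of whole sequences and the finger property\<close>

lemma zigzag_tree_Nil [simp]: "zigzag_tree p [] = return_pmf \<langle>\<rangle>"
  by (simp add: zigzag_tree_def)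

lemma zigzag_tree_snoc [simp]: "zigzag_tree p (xs @ [x]) = zigzag_tree p xs \<bind> insert_zigzag p x"
  by (simp add: zigzag_tree_def)

lemma finite_set_pmf_zigzag_tree [simp]: "finite (set_pmf (zigzag_tree p xs))"
  by (induction xs rule: rev_induct) (auto simp: finite_set_pmf_insert_zigzag)

lemma zigzag_tree_bst:
  "t \<in> set_pmf (zigzag_tree p xs) \<Longrightarrow> bst t \<and> set_tree t = set xs"
proof (induction xs arbitrary: t rule: rev_induct)
  case (snoc x xs)
  then show ?case
    by (auto simp: insert_zigzag_def rebalance_zigzag_def Let_def bst_insert_leaf)
qed simp

lemma finger_seq_snocD:
  assumes "finger_seq (xs @ [y])"
  shows "finger_seq xs"
  unfolding finger_seq_def Let_def
proof (intro conjI allI impI)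
  show "distinct xs" using assms by (simp add: finger_seq_def)
  fix i assume "Suc i < length xs"
  then show "imm_pred (set (take (Suc (Suc i)) xs)) (xs ! Suc i) (xs ! i) \<or>
      imm_pred (set (take (Suc (Suc i)) xs)) (xs ! i) (xs ! Suc i)"
    using assms[unfolded finger_seq_def Let_def, THEN conjunct2, rule_format, of i]
    by (simp add: nth_append)
qed

text \<open>No older key separates two consecutive keys, so both fall into the same gap of the older
  keys. This is the form in which the one-step estimates use the finger property.\<close>

lemma finger_seq_neighbour:
  assumes "finger_seq (xs @ [x, y])"
  shows "x \<notin> set xs" "y \<notin> set xs" "x \<noteq> y" "a \<in> set xs \<Longrightarrow> a < x \<longleftrightarrow> a < y"
proof -
  have "distinct (xs @ [x, y])" using assms by (simp add: finger_seq_def)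
  then show ne: "x \<notin> set xs" "y \<notin> set xs" "x \<noteq> y" by auto
  have "imm_pred (set (xs @ [x, y])) y x \<or> imm_pred (set (xs @ [x, y])) x y"
    using assms[unfolded finger_seq_def Let_def, THEN conjunct2, rule_format, of "length xs"]
    by (simp add: nth_append)
  then show "a < x \<longleftrightarrow> a < y" if "a \<in> set xs"
    using ne that unfolding imm_pred_def
    by (metis (no_types, lifting) UnCI linorder_neqE order.strict_trans set_append)
qed

section \<open>Induction along a finger sequence\<close>

context
  fixes p :: real
  assumes p_bounds: "0 < p" "p < 1" and golden: "1 - p \<le> p\<^sup>2"
begin

text \<open>The comparison is with the insertion depth of the next key \<open>y\<close>, which
  varies in the induction: the hypothesis for \<open>xs\<close> is used with the last key
  \<open>x\<close> in the role of \<open>y\<close>. Both estimates then follow from the exact law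
  for the next insertion depth.\<close>

lemma expectation_depth_le_insertion_depth:
  assumes "finger_seq (xs @ [y])"
  shows "z \<in> set xs \<Longrightarrow> measure_pmf.expectation (zigzag_tree p xs) (\<lambda>t. real (depth z t)) \<le>
      measure_pmf.expectation (zigzag_tree p xs) (\<lambda>t. real (depth y (insert_leaf y t)))"
    and "measure_pmf.expectation (zigzag_tree p xs) (\<lambda>t. (1 / p) ^ depth y (insert_leaf y t)) \<le>
      1 + length xs * ((1 / p - 1) / p)"
  using assms
proof (induction xs arbitrary: y rule: rev_induct)
  case Nil
  { case 1 then show ?case by simp }
  { case 2 show ?case by (simp add: depth_def) }
next
  case (snoc x xs)
  let ?E = "measure_pmf.expectation (zigzag_tree p xs)"
  let ?D = "\<lambda>t. depth x (insert_leaf x t)"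
  have int: "integrable (measure_pmf (zigzag_tree p xs)) f" for f :: "'a tree \<Rightarrow> real"
    by (simp add: integrable_measure_pmf_finite)
  have mono: "?E f \<le> ?E g" if "\<And>t. t \<in> set_pmf (zigzag_tree p xs) \<Longrightarrow> f t \<le> g t"
    for f g :: "'a tree \<Rightarrow> real"
    using that by (intro integral_mono_AE int) (simp add: AE_measure_pmf_iff)
  have next_depth: "measure_pmf.expectation (zigzag_tree p (xs @ [x]))
        (\<lambda>t. f (depth y (insert_leaf y t))) =
      ?E (\<lambda>t. f (?D t) + p ^ (?D t - 1) * (f (Suc (?D t)) - f (?D t)))"
    if "finger_seq ((xs @ [x]) @ [y])" for f :: "nat \<Rightarrow> real" and y
  proof -
    have fs: "finger_seq (xs @ [x, y])" using that by simp
    note nb = finger_seq_neighbour[OF fs]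
    show ?thesis
      unfolding zigzag_tree_snoc
    proof (subst expectation_bind_finite, goal_cases)
      case 3
      show ?case
      proof (intro integral_cong_AE, goal_cases)
        case 3
        show ?case
          unfolding AE_measure_pmf_iff
          using p_bounds zigzag_tree_bst nb
          by (intro ballI expectation_next_insertion_depth) auto
      qed simp_all
    qed (simp_all add: finite_set_pmf_insert_zigzag)
  qed
  { case 1
    have fs: "finger_seq (xs @ [x])" using finger_seq_snocD[OF 1(2)] .
    \<comment> \<open>The expected insertion depth rises by exactly the mean of
      \<open>p ^ (?D t - 1)\<close>, which also bounds the rise of any old key.\<close>
    have D: "measure_pmf.expectation (zigzag_tree p (xs @ [x]))
        (\<lambda>t. real (depth y (insert_leaf y t))) = ?E (\<lambda>t. ?D t + p ^ (?D t - 1))"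
      using next_depth[OF 1(2), of real] by simp
    show ?case
    proof (cases "z \<in> set xs")
      case True
      have "measure_pmf.expectation (zigzag_tree p (xs @ [x])) (\<lambda>t. real (depth z t)) =
          ?E (\<lambda>t. measure_pmf.expectation (insert_zigzag p x t) (\<lambda>s. real (depth z s)))"
        by (simp add: expectation_bind_finite finite_set_pmf_insert_zigzag)
      also have "\<dots> \<le> ?E (\<lambda>t. depth z t + p ^ (?D t - 1))"
        using p_bounds golden True zigzag_tree_bst
        by (intro mono expectation_depth_old) auto
      also have "\<dots> = ?E (\<lambda>t. depth z t) + ?E (\<lambda>t. p ^ (?D t - 1))"
        by (simp add: int)
      also have "\<dots> \<le> ?E ?D + ?E (\<lambda>t. p ^ (?D t - 1))"
        using snoc.IH(1)[OF True fs] by simp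
      finally show ?thesis unfolding D by (simp add: int)
    next
      case False
      then have "z = x" using 1 by auto
      have "measure_pmf.expectation (zigzag_tree p (xs @ [x])) (\<lambda>t. real (depth x t)) =
          ?E (\<lambda>t. measure_pmf.expectation (insert_zigzag p x t) (\<lambda>s. real (depth x s)))"
        by (simp add: expectation_bind_finite finite_set_pmf_insert_zigzag)
      also have "\<dots> \<le> ?E ?D"
        using p_bounds zigzag_tree_bst by (intro mono expectation_depth_new) auto
      also have "\<dots> \<le> ?E (\<lambda>t. ?D t + p ^ (?D t - 1))"
        using p_bounds by (intro mono) simp
      finally show ?thesis unfolding D \<open>z = x\<close> .
    qed
  }
  { case 2
    have fs: "finger_seq (xs @ [x])" using finger_seq_snocD[OF 2] .
    \<comment> \<open>For \<open>m > 0\<close> this is an equality: the base \<open>1 / p\<close>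
      makes the growth of the power offset its probability. For \<open>m = 0\<close> the probability
      is 1, and \<open>1 / p \<ge> 1\<close> supplies the slack.\<close>
    have *: "p ^ (m - 1) * ((1 / p) ^ Suc m - (1 / p) ^ m) \<le> (1 / p - 1) / p" for m
    proof (cases m)
      case 0
      have "(1 / p - 1) * 1 \<le> (1 / p - 1) * (1 / p)"
        using p_bounds by (intro mult_left_mono) auto
      then show ?thesis using 0 by simp
    next
      case (Suc i)
      then show ?thesis using p_bounds by (simp add: field_simps)
    qed
    have "measure_pmf.expectation (zigzag_tree p (xs @ [x]))
        (\<lambda>t. (1 / p) ^ depth y (insert_leaf y t)) \<le> ?E (\<lambda>t. (1 / p) ^ ?D t + (1 / p - 1) / p)"
      unfolding next_depth[OF 2] using * by (intro mono add_left_mono)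
    also have "\<dots> = ?E (\<lambda>t. (1 / p) ^ ?D t) + (1 / p - 1) / p"
      by (simp add: int)
    also have "\<dots> \<le> 1 + length (xs @ [x]) * ((1 / p - 1) / p)"
      using snoc.IH(2)[OF fs]
      by (simp only: length_append_singleton of_nat_Suc distrib_right)
    finally show ?case .
  }
qed

section \<open>The logarithmic bound\<close>

text \<open>The fraction bounds the expected insertion depth of the last key; the final 1 pays for
  what an older key may lose in that last insertion.\<close>

definition depth_bound :: "nat \<Rightarrow> real" where
  "depth_bound n = (ln n + (1 / p - 1) / p) / ln (1 / p) + 1"

lemma expectation_depth_le:
  assumes fs: "finger_seq xs" and z: "z \<in> set xs"
  shows "measure_pmf.expectation (zigzag_tree p xs) (\<lambda>t. real (depth z t)) \<le>
    depth_bound (length xs)"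
proof -
  obtain ys x where xs: "xs = ys @ [x]" using z by (cases xs rule: rev_cases) auto
  define n where "n = length xs"
  have "0 < n" by (simp add: n_def xs)
  let ?E = "measure_pmf.expectation (zigzag_tree p ys)"
  let ?D = "\<lambda>t. depth x (insert_leaf x t)"
  let ?c = "(1 / p - 1) / p"
  have int: "integrable (measure_pmf (zigzag_tree p ys)) f" for f :: "'a tree \<Rightarrow> real"
    by (simp add: integrable_measure_pmf_finite)
  have mono: "?E f \<le> ?E g" if "\<And>t. t \<in> set_pmf (zigzag_tree p ys) \<Longrightarrow> f t \<le> g t"
    for f g :: "'a tree \<Rightarrow> real"
    using that by (intro integral_mono_AE int) (simp add: AE_measure_pmf_iff)
  have "0 \<le> ?c" "0 < ln (1 / p)" using p_bounds by auto
  have "measure_pmf.expectation (zigzag_tree p xs) (\<lambda>t. real (depth z t)) =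
      ?E (\<lambda>t. measure_pmf.expectation (insert_zigzag p x t) (\<lambda>s. real (depth z s)))"
    by (simp add: xs expectation_bind_finite finite_set_pmf_insert_zigzag)
  also have "\<dots> \<le> ?E ?D + 1"
  proof (cases "z \<in> set ys")
    case True
    have "?E (\<lambda>t. measure_pmf.expectation (insert_zigzag p x t) (\<lambda>s. real (depth z s))) \<le>
        ?E (\<lambda>t. depth z t + 1)"
    proof (intro mono)
      fix t assume "t \<in> set_pmf (zigzag_tree p ys)"
      then have "bst t" "z \<in> set_tree t" using True zigzag_tree_bst by auto
      then have "measure_pmf.expectation (insert_zigzag p x t) (\<lambda>s. real (depth z s)) \<le>
          depth z t + p ^ (?D t - 1)"
        using p_bounds golden by (intro expectation_depth_old) auto
      also have "\<dots> \<le> depth z t + 1" using p_bounds by (simp add: power_le_one)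
      finally show "measure_pmf.expectation (insert_zigzag p x t) (\<lambda>s. real (depth z s)) \<le>
          depth z t + 1" by simp
    qed
    then show ?thesis
      using expectation_depth_le_insertion_depth(1)[OF fs[unfolded xs] True] by (simp add: int)
  next
    case False
    then have "z = x" using z xs by auto
    have "?E (\<lambda>t. measure_pmf.expectation (insert_zigzag p x t) (\<lambda>s. real (depth z s))) \<le> ?E ?D"
      unfolding \<open>z = x\<close>
      using p_bounds zigzag_tree_bst by (intro mono expectation_depth_new) auto
    then show ?thesis by simp
  qed
  also have "?E ?D \<le> (ln n + ?c) / ln (1 / p)"
  proof -
    \<comment> \<open>The tangent inequality \<open>ln u \<le> u - 1\<close> takes the place of
      Jensen's inequality. Dividing by \<open>n\<close> is the right scale, since the mean of
      \<open>(1 / p) ^ ?D t\<close> is at most \<open>(1 + ?c) * n\<close>.\<close>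
    have pointwise: "real m * ln (1 / p) \<le> ln n + (1 / p) ^ m / n - 1" for m :: nat
    proof -
      have "real m * ln (1 / p) - ln n = ln ((1 / p) ^ m / n)"
        using p_bounds \<open>0 < n\<close> by (simp add: ln_div ln_mult ln_realpow power_one_over)
      also have "\<dots> \<le> (1 / p) ^ m / n - 1"
        using p_bounds \<open>0 < n\<close> by (intro ln_le_minus_one) auto
      finally show ?thesis by simp
    qed
    have "?E ?D * ln (1 / p) = ?E (\<lambda>t. ?D t * ln (1 / p))" by simp
    also have "\<dots> \<le> ?E (\<lambda>t. ln n + (1 / p) ^ ?D t / n - 1)"
      by (intro mono pointwise)
    also have "\<dots> = ln n - 1 + ?E (\<lambda>t. (1 / p) ^ ?D t) / n"
      by (simp add: int)
    also have "?E (\<lambda>t. (1 / p) ^ ?D t) / n \<le> 1 + ?c"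
    proof -
      have "?E (\<lambda>t. (1 / p) ^ ?D t) \<le> 1 + length ys * ?c"
        by (rule expectation_depth_le_insertion_depth(2)[OF fs[unfolded xs]])
      also have "\<dots> \<le> (1 + ?c) * n"
      proof -
        have "1 + real m * c \<le> (1 + c) * real (Suc m)" if "0 \<le> c" for c :: real and m
          using that by (simp add: algebra_simps)
        then show ?thesis
          using \<open>0 \<le> ?c\<close> by (simp only: n_def xs length_append_singleton)
      qed
      finally show ?thesis using \<open>0 < n\<close> by (simp only: pos_divide_le_eq of_nat_0_less_iff)
    qed
    finally have "?E ?D * ln (1 / p) \<le> ln n + ?c" by simp
    then show ?thesis using \<open>0 < ln (1 / p)\<close> by (simp add: pos_le_divide_eq)
  qed
  finally show ?thesis by (simp add: depth_bound_def n_def)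
qed

lemma depth_bound_bigo: "depth_bound \<in> O(\<lambda>n. log 2 (real n))"
proof -
  have "(\<lambda>n::nat. ln (real n) * (1 / ln (1 / p)) + ((1 / p - 1) / p / ln (1 / p) + 1)) \<in>
      O(\<lambda>n. ln (real n))"
  proof (rule sum_in_bigo)
    show "(\<lambda>n::nat. ln (real n) * (1 / ln (1 / p))) \<in> O(\<lambda>n. ln (real n))"
      by (rule bigoI[where c = "\<bar>1 / ln (1 / p)\<bar>"]) (simp add: abs_mult)
    show "(\<lambda>n::nat. (1 / p - 1) / p / ln (1 / p) + 1) \<in> O(\<lambda>n. ln (real n))"
    proof (rule bigoI[where c = "\<bar>(1 / p - 1) / p / ln (1 / p) + 1\<bar>"])
      have "norm ((1 / p - 1) / p / ln (1 / p) + 1) \<le>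
          \<bar>(1 / p - 1) / p / ln (1 / p) + 1\<bar> * norm (ln (real n))" if "3 \<le> n" for n
      proof -
        \<comment> \<open>The threshold 3 exceeds \<open>exp 1\<close>, so from there on
          \<open>ln n \<ge> 1\<close> absorbs the constant term.\<close>
        have "exp 1 \<le> real n" using exp_le that by linarith
        then have "1 \<le> ln (real n)" using that by (subst ln_ge_iff) auto
        then show ?thesis
          using mult_left_mono[of 1 "ln (real n)" "\<bar>(1 / p - 1) / p / ln (1 / p) + 1\<bar>"] by simp
      qed
      then show "\<forall>\<^sub>F n in sequentially. norm ((1 / p - 1) / p / ln (1 / p) + 1) \<le>
          \<bar>(1 / p - 1) / p / ln (1 / p) + 1\<bar> * norm (ln (real n))"
        unfolding eventually_sequentially by blast
    qed
  qed
  also have "(\<lambda>n::nat. ln (real n)) \<in> O(\<lambda>n. log 2 (real n))"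
    by (simp add: log_def)
  finally show ?thesis
    unfolding depth_bound_def[abs_def] by (simp add: add_divide_distrib add.assoc)
qed

end

section \<open>Converging sequences are finger sequences\<close>

lemma finger_seq_snocI:
  assumes "finger_seq (xs @ [x])" "y \<notin> set (xs @ [x])"
    and "\<And>a. a \<in> set xs \<Longrightarrow> a < x \<longleftrightarrow> a < y"
  shows "finger_seq (xs @ [x, y])"
  unfolding finger_seq_def Let_def
proof (intro conjI allI impI)
  show "distinct (xs @ [x, y])" using assms by (auto simp: finger_seq_def)
  fix i assume "Suc i < length (xs @ [x, y])"
  then consider "i = length xs" | "Suc i < length (xs @ [x])" by fastforce
  then show "imm_pred (set (take (Suc (Suc i)) (xs @ [x, y]))) ((xs @ [x, y]) ! Suc i) ((xs @ [x, y]) ! i)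
    \<or> imm_pred (set (take (Suc (Suc i)) (xs @ [x, y]))) ((xs @ [x, y]) ! i) ((xs @ [x, y]) ! Suc i)"
  proof cases
    case 1
    have "x \<notin> set xs" "x \<noteq> y" "y \<notin> set xs" using assms by (auto simp: finger_seq_def)
    then have "imm_pred (set (xs @ [x, y])) y x \<or> imm_pred (set (xs @ [x, y])) x y"
      using assms(3) unfolding imm_pred_def
      by (cases x y rule: linorder_cases) (auto, (meson less_asym)+)
    then show ?thesis using 1 by (simp add: nth_append)
  next
    case 2
    \<comment> \<open>The condition at an earlier index only sees a prefix without
      \<open>y\<close>.\<close>
    have "take (Suc (Suc i)) (xs @ [x, y]) = take (Suc (Suc i)) (xs @ [x])"
      using 2 by (cases "Suc i = length xs") auto
    with 2 show ?thesis
      using assms(1)[unfolded finger_seq_def Let_def, THEN conjunct2, rule_format, of i]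
      by (auto simp: nth_append simp del: take_append)
  qed
qed

lemma finger_seq_converging:
  assumes "even n"
  shows "finger_seq (converging n) \<and> set (converging n) = {1..n} \<and> length (converging n) = n"
proof -
  define C where "C m = concat (map (\<lambda>i. [i, n + 1 - i]) [1..<Suc m])" for m
  have C_Suc: "C (Suc m) = C m @ [Suc m, n - m]" for m by (simp add: C_def)
  have set_C: "set (C m) = {1..m} \<union> {n + 1 - m..n}" if "m \<le> n" for m
    using that by (induction m) (auto simp: C_Suc, simp add: C_def)
  have length_C: "length (C m) = 2 * m" for m
    by (induction m) (simp_all add: C_Suc, simp add: C_def)
  have turn: "finger_seq (C m @ [Suc m, n - m])"
    if "finger_seq (C m @ [Suc m])" "2 * m + 2 \<le> n" for m
    using that by (intro finger_seq_snocI) (auto simp: set_C)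
  \<comment> \<open>The induction runs over prefixes ending in a low key; \<open>turn\<close> adds
    the matching high key, and the inductive step adds the next low one.\<close>
  have fs: "finger_seq (C m @ [Suc m])" if "2 * m + 2 \<le> n" for m
    using that
  proof (induction m)
    case 0
    then show ?case by (simp add: C_def finger_seq_def)
  next
    case (Suc m)
    then have "finger_seq ((C m @ [Suc m]) @ [n - m, Suc (Suc m)])"
      using turn[of m] by (intro finger_seq_snocI) (auto simp: set_C)
    then show ?case by (simp add: C_Suc)
  qed
  obtain k where k: "n = 2 * k" using assms by blast
  then have "converging n = C k" by (simp add: converging_def C_def)
  moreover have "finger_seq (C k)"
  proof (cases k)
    case 0
    then show ?thesis by (simp add: C_def finger_seq_def)
  next
    case (Suc m)
    then show ?thesis using turn[of m] fs[of m] k by (simp add: C_Suc)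
  qed
  ultimately show ?thesis using set_C[of k] length_C[of k] k by auto
qed

theorem theorem6:
  fixes p :: real
  assumes "(sqrt 5 - 1) / 2 < p" and "p < 1"
  shows "\<exists>g \<in> O(\<lambda>n::nat. log 2 (real n)).
     (\<forall>n. even n \<longrightarrow>
        (\<forall>t \<in> set_pmf (zigzag_tree p (converging n)). bst t \<and> set_tree t = {1..n}) \<and>
        (\<forall>x \<in> {1..n}.
           measure_pmf.expectation (zigzag_tree p (converging n)) (\<lambda>t. real (depth x t)) \<le> g n)) \<and>
     (\<forall>xs :: 'a::linorder list. finger_seq xs \<longrightarrow>
        (\<forall>t \<in> set_pmf (zigzag_tree p xs). bst t \<and> set_tree t = set xs) \<and>
        (\<forall>x \<in> set xs.
           measure_pmf.expectation (zigzag_tree p xs) (\<lambda>t. real (depth x t)) \<le> g (length xs)))"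
proof -
  have "0 < (sqrt 5 - 1) / 2" by simp
  then have p: "0 < p" using assms(1) by (rule less_trans)
  \<comment> \<open>Squaring gives \<open>5 \<le> 4 * p\<^sup>2 + 4 * p + 1\<close>, which is the
    golden ratio condition.\<close>
  have "sqrt 5 \<le> 2 * p + 1" using assms(1) by (simp add: field_simps)
  then have "(sqrt 5)\<^sup>2 \<le> (2 * p + 1)\<^sup>2" by (intro power_mono) auto
  then have golden: "1 - p \<le> p\<^sup>2" by (simp add: power2_eq_square algebra_simps)
  note bound = expectation_depth_le[OF p assms(2) golden]
  show ?thesis
  \<comment> \<open>The bound depends only on \<open>p\<close> and the length, so one function
    serves both kinds of sequence.\<close>
  proof (intro bexI[where x = "depth_bound p"] conjI allI impI)
    show "depth_bound p \<in> O(\<lambda>n. log 2 (real n))"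
      by (rule depth_bound_bigo[OF p assms(2) golden])
  next
    fix n :: nat assume "even n"
    note conv = finger_seq_converging[OF this]
    show "\<forall>t \<in> set_pmf (zigzag_tree p (converging n)). bst t \<and> set_tree t = {1..n}"
      using zigzag_tree_bst[of _ p "converging n"] conv by auto
    show "\<forall>x \<in> {1..n}.
        measure_pmf.expectation (zigzag_tree p (converging n)) (\<lambda>t. real (depth x t)) \<le> depth_bound p n"
      using bound[of "converging n"] conv by simp
  next
    fix xs :: "'a list" assume "finger_seq xs"
    then show "\<forall>x \<in> set xs. measure_pmf.expectation (zigzag_tree p xs) (\<lambda>t. real (depth x t)) \<le>
        depth_bound p (length xs)"
      using bound by blast
    show "\<forall>t \<in> set_pmf (zigzag_tree p xs). bst t \<and> set_tree t = set xs"
      using zigzag_tree_bst by blast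
  qed
qed

end
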